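(* Let $X$ be a real Hilbert space and let $B:X\times X\to\mathbb R$ be a continuous symmetric essentially positive bilinear form on $X$. Let $W\subset X$ be a closed subspace and let $S=\{x\in X: B(x,y)=0\ \text{for all } y\in W\}$ be the $B$-orthogonal space of $W$. Then $$\mathrm n_-(B)=\mathrm n_-\big(B|_{W\times W}\big)+\mathrm n_-\big(B|_{S\times S}\big)+\dim(W\cap S)-\dim\big(W\cap\operatorname{Ker}(B)\big),$$ and all the terms in this equality are finite natural numbers.
   Context: For a symmetric bilinear form $B$ on a real vector space $X$: $\operatorname{Ker}(B)=\{x\in X: B(x,y)=0\ \forall y\in X\}$, and the index $\mathrm n_-(B)\in\mathbb N\cup\{+\infty\}$ is the supremum of the dimensions of the subspaces of $X$ on which $B$ is negative definite. A continuous symmetric bilinear form $B$ on a Hilbert space $(X,\langle\cdot,\cdot\rangle)$ is essentially positive if the bounded operator $T:X\to X$ with $B(x,y)=\langle Tx,y\rangle$ is of the form $T=P+K$, where $P$ is a positive isomorphism of $X$ (i.e., $P$ is a bounded isomorphism and $\langle P\cdot,\cdot\rangle$ is symmetric and positive semi-definite) and $K$ is a compact (symmetric) operator. *)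

theory Defs
  imports "HOL-Analysis.Analysis" "HOL-Library.Extended_Nat"
begin

text \<open>The library's \<^term>\<open>dim\<close> is 0 on infinite-dimensional subspaces; \<open>edim\<close> is \<open>\<infinity>\<close> there.\<close>

definition edim :: "'a::real_vector set \<Rightarrow> enat" where
  "edim V = (if \<exists>A. finite A \<and> V \<subseteq> span A then enat (dim V) else \<infinity>)"

definition symmetric_form :: "('a \<Rightarrow> 'a \<Rightarrow> real) \<Rightarrow> bool" where
  "symmetric_form B \<longleftrightarrow> (\<forall>x y. B x y = B y x)"

text \<open>In the following, the argument \<open>V\<close> is the subspace to which the form \<open>B\<close> is restricted;
  \<open>V = UNIV\<close> gives the notion for \<open>B\<close> itself.\<close>

definition form_ker :: "'a set \<Rightarrow> ('a \<Rightarrow> 'a \<Rightarrow> real) \<Rightarrow> 'a set" where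
  "form_ker V B = {x \<in> V. \<forall>y\<in>V. B x y = 0}"

definition neg_definite_on :: "'a::real_vector set \<Rightarrow> ('a \<Rightarrow> 'a \<Rightarrow> real) \<Rightarrow> bool" where
  "neg_definite_on U B \<longleftrightarrow> (\<forall>x\<in>U. x \<noteq> 0 \<longrightarrow> B x x < 0)"

definition neg_index :: "'a::real_vector set \<Rightarrow> ('a \<Rightarrow> 'a \<Rightarrow> real) \<Rightarrow> enat" where
  "neg_index V B = (SUP U \<in> {U. subspace U \<and> U \<subseteq> V \<and> neg_definite_on U B}. edim U)"

definition form_orthogonal :: "('a \<Rightarrow> 'a \<Rightarrow> real) \<Rightarrow> 'a set \<Rightarrow> 'a set" where
  "form_orthogonal B W = {x. \<forall>y\<in>W. B x y = 0}"

definition compact_operator :: "('a::real_normed_vector \<Rightarrow> 'b::real_normed_vector) \<Rightarrow> bool" where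
  "compact_operator K \<longleftrightarrow>
     bounded_linear K \<and> (\<forall>A. bounded A \<longrightarrow> compact (closure (K ` A)))"

definition symmetric_operator :: "('a::real_inner \<Rightarrow> 'a) \<Rightarrow> bool" where
  "symmetric_operator T \<longleftrightarrow> (\<forall>x y. T x \<bullet> y = x \<bullet> T y)"

definition positive_isomorphism :: "('a::real_inner \<Rightarrow> 'a) \<Rightarrow> bool" where
  "positive_isomorphism P \<longleftrightarrow>
     bounded_linear P \<and> bij P \<and> bounded_linear (inv P) \<and>
     symmetric_form (\<lambda>x y. P x \<bullet> y) \<and> (\<forall>x. P x \<bullet> x \<ge> 0)"

definition essentially_positive :: "('a::real_inner \<Rightarrow> 'a \<Rightarrow> real) \<Rightarrow> bool" where
  "essentially_positive B \<longleftrightarrow>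
     (\<exists>T. bounded_linear T \<and> (\<forall>x y. B x y = T x \<bullet> y) \<and>
       (\<exists>P K. positive_isomorphism P \<and> compact_operator K \<and> symmetric_operator K \<and>
              T = (\<lambda>x. P x + K x)))"

end

theory Submission
  imports Defs
begin

text \<open>
  Essential positivity gives a Garding inequality \<open>c \<parallel>x\<parallel>\<^sup>2 \<le> B x x + \<parallel>K x\<parallel> \<parallel>x\<parallel>\<close> with \<open>K\<close> compact, so
  subspaces on which \<open>B\<close> is nonpositive are finite-dimensional. A maximal negative definite subspace
  of \<open>V\<close> then exists by Zorn's lemma, \<open>B\<close> is nonnegative on its \<open>B\<close>-orthogonal in \<open>V\<close>, and hence its
  dimension is the index of \<open>V\<close>.

  Let \<open>A\<close> and \<open>C\<close> be bases of maximal negative definite subspaces of \<open>W\<close> and \<open>S\<close>, and let \<open>F\<close> be a basis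
  of a complement of \<open>W \<inter> Ker B\<close> in \<open>W \<inter> S\<close>. Then \<open>D = A \<union> C \<union> F\<close> is independent, and the index of
  \<open>B\<close> is \<open>card D\<close>. It is at least that, because \<open>B\<close> is nonpositive on \<open>span D\<close> and \<open>span D\<close> meets
  \<open>Ker B\<close> trivially, so \<open>span D\<close> also meets trivially the \<open>B\<close>-orthogonal of a maximal negative
  definite subspace. It is at most that, because any \<open>x\<close> that is \<open>B\<close>-orthogonal to \<open>D\<close> is orthogonal to
  \<open>W \<inter> S\<close> and splits as \<open>x = w + s\<close> with \<open>w \<in> W\<close> orthogonal to \<open>A\<close> and \<open>s \<in> S\<close> orthogonal to \<open>C\<close>;
  therefore \<open>B x x = B w w + B s s \<ge> 0\<close>.
\<close>

section \<open>Linear algebra\<close>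

text \<open>Serves to join bases of the summands of a direct sum one after another. If a new
  \<open>c\<close> were \<open>a + c'\<close> with \<open>a\<close> in \<open>span A\<close> and
  \<open>c'\<close> in \<open>span C\<close>, then \<open>a = c - c'\<close> would lie in both spans
  and vanish, contradicting independence of \<open>insert c C\<close>.\<close>

lemma independent_Un_if_span_Int:
  fixes A C :: "'a::real_vector set"
  assumes "finite C" "independent A" "independent C" "span A \<inter> span C \<subseteq> {0}"
  shows "independent (A \<union> C)"
  using assms(1,3,4)
proof (induction C rule: finite_induct)
  case empty
  then show ?case using assms(2) by simp
next
  case (insert c C)
  have cC: "c \<notin> span C" and indC: "independent C"
    using insert.prems(1) insert.hyps(2) by (auto simp: independent_insert)
  have "span A \<inter> span C \<subseteq> {0}"
    using insert.prems(2) span_mono[of C "insert c C"] by blast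
  then have IH: "independent (A \<union> C)"
    using insert.IH indC by blast
  have "c \<notin> span (A \<union> C)"
  proof
    assume "c \<in> span (A \<union> C)"
    then obtain a c' where a: "a \<in> span A" and c': "c' \<in> span C" and eq: "c = a + c'"
      unfolding span_Un by blast
    have "c' \<in> span (insert c C)"
      using c' span_mono[of C "insert c C"] by blast
    then have "c - c' \<in> span (insert c C)"
      using span_diff[OF span_base[of c "insert c C"]] by blast
    then have "a = 0"
      using a eq insert.prems(2) by auto
    then show False using eq c' cC by simp
  qed
  then show ?case
    using IH by (simp add: independent_insertI)
qed

lemma span_Int_if_independent_Un:
  fixes A C :: "'a::real_vector set"
  assumes "finite C" "independent (A \<union> C)" "A \<inter> C = {}"
  shows "span A \<inter> span C \<subseteq> {0}"
  using assms
proof (induction C rule: finite_induct)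
  case empty
  then show ?case by simp
next
  case (insert c C)
  have cAC: "c \<notin> A \<union> C" using insert.hyps insert.prems(2) by auto
  have indAC: "independent (A \<union> C)" and c: "c \<notin> span (A \<union> C)"
    using insert.prems(1) cAC by (auto simp: independent_insert)
  have IH: "span A \<inter> span C \<subseteq> {0}"
    using insert.IH indAC insert.prems(2) by blast
  show ?case
  proof
    fix x assume x: "x \<in> span A \<inter> span (insert c C)"
    then obtain t where t: "x - t *\<^sub>R c \<in> span C"
      using span_breakdown_eq by blast
    have "t = 0"
    proof (rule ccontr)
      assume "t \<noteq> 0"
      have "x \<in> span (A \<union> C)" "x - t *\<^sub>R c \<in> span (A \<union> C)"
        using x t span_mono[of A "A \<union> C"] span_mono[of C "A \<union> C"] by auto
      then have "x - (x - t *\<^sub>R c) \<in> span (A \<union> C)"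
        by (rule span_diff)
      then have "t *\<^sub>R c \<in> span (A \<union> C)" by simp
      then have "(1/t) *\<^sub>R (t *\<^sub>R c) \<in> span (A \<union> C)"
        by (rule span_scale)
      then show False using \<open>t \<noteq> 0\<close> c by simp
    qed
    then show "x \<in> {0}" using x t IH by auto
  qed
qed

lemma edim_eq_card_basis:
  assumes "finite A" "independent A" "V \<subseteq> span A" "A \<subseteq> V"
  shows "edim V = enat (card A)"
  using assms basis_card_eq_dim[of A V] unfolding edim_def by auto

lemma edim_le_card:
  assumes "finite A" "V \<subseteq> span A"
  shows "edim V \<le> enat (card A)"
  using assms dim_le_card[of V A] unfolding edim_def by auto

text \<open>Each functional lowers the dimension by at most one on passing to its kernel, hence the
  induction on \<open>C\<close> with \<open>V\<close> arbitrary. Applied with \<open>f = B\<close>,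
  this turns trivial intersection with a \<open>B\<close>-orthogonal space into a dimension
  bound.\<close>

lemma finite_dim_if_common_kernel_trivial:
  fixes f :: "'c \<Rightarrow> 'a::real_vector \<Rightarrow> real"
  assumes "finite C" "\<And>c. linear (f c)" "subspace V"
    and "\<And>x. x \<in> V \<Longrightarrow> \<forall>c\<in>C. f c x = 0 \<Longrightarrow> x = 0"
  shows "\<exists>A. finite A \<and> card A \<le> card C \<and> V \<subseteq> span A"
  using assms(1,3,4)
proof (induction C arbitrary: V rule: finite_induct)
  case empty
  then have "V \<subseteq> span {}" by auto
  then show ?case by (intro exI[of _ "{}"]) auto
next
  case (insert c C)
  let ?V = "{x \<in> V. f c x = 0}"
  have "subspace ?V"
    using insert.prems(1)
    by (auto simp: subspace_def linear_add[OF assms(2)] linear_scale[OF assms(2)] linear_0[OF assms(2)])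
  then obtain A where A: "finite A" "card A \<le> card C" "?V \<subseteq> span A"
    using insert.IH[of ?V] insert.prems(2) by blast
  show ?case
  proof (cases "V \<subseteq> ?V")
    case True
    then show ?thesis
      using A insert.hyps by (intro exI[of _ A]) (auto simp: le_SucI)
  next
    case False
    then obtain v where v: "v \<in> V" "f c v \<noteq> 0" by auto
    have "x \<in> span (insert v A)" if "x \<in> V" for x
    proof -
      have "x - (f c x / f c v) *\<^sub>R v \<in> ?V"
        using that v insert.prems(1)
        by (simp add: subspace_diff subspace_scale linear_diff[OF assms(2)] linear_scale[OF assms(2)])
      then show ?thesis
        using A(3) span_breakdown_eq by blast
    qed
    moreover have "card (insert v A) \<le> card (insert c C)"
      using A insert.hyps card_insert_le_m1[of "Suc (card C)" A v] by (simp add: card_insert_if)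
    ultimately show ?thesis
      using A(1) by (intro exI[of _ "insert v A"]) auto
  qed
qed

section \<open>Symmetric bilinear forms\<close>

locale symmetric_bilinear = bounded_bilinear B
  for B :: "'a::real_normed_vector \<Rightarrow> 'a \<Rightarrow> real" +
  assumes sym: "B x y = B y x"
begin

lemmas form_simps = add_left add_right diff_left diff_right scaleR_left scaleR_right
  zero_left zero_right minus_left minus_right

lemma linear_form: "linear (B x)"
  by (rule linearI) (simp_all add: form_simps)

lemma subspace_perp: "subspace {y. \<forall>x\<in>A. B y x = 0}"
  by (auto simp: subspace_def form_simps)

lemma perp_span:
  assumes "\<And>y. y \<in> A \<Longrightarrow> B x y = 0" "y \<in> span A"
  shows "B x y = 0"
proof -
  have "subspace {y. B x y = 0}" by (auto simp: subspace_def form_simps)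
  then show ?thesis using span_minimal[of A "{y. B x y = 0}"] assms by blast
qed

text \<open>Degenerate case of Cauchy-Schwarz: along \<open>y + t *\<^sub>R x\<close> the form is
  affine in \<open>t\<close> with slope \<open>2 * B x y\<close>, so a nonzero slope would make it
  negative somewhere.\<close>

lemma semidefinite_null_perp:
  assumes V: "subspace V" and nonneg: "\<And>y. y \<in> V \<Longrightarrow> 0 \<le> B y y"
    and x: "x \<in> V" "B x x = 0" and y: "y \<in> V"
  shows "B x y = 0"
proof (rule ccontr)
  assume ne: "B x y \<noteq> 0"
  \<comment> \<open>Solves \<open>B y y + 2 * t * B x y = -1\<close>.\<close>
  define t where "t = - (B y y + 1) / (2 * B x y)"
  have "0 \<le> B (y + t *\<^sub>R x) (y + t *\<^sub>R x)"
    using V x y by (intro nonneg) (simp add: subspace_add subspace_scale)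
  also have "\<dots> = B y y + 2 * t * B x y"
    using x(2) sym[of y x] by (simp add: form_simps)
  also have "\<dots> = -1"
    using ne by (simp add: t_def field_simps)
  finally show False by simp
qed

text \<open>Gram-Schmidt with division by \<open>B u u\<close>, whose sign is irrelevant. It
  therefore covers both negative definite subspaces and the inner product.\<close>

lemma anisotropic_projection:
  assumes "finite A" "\<And>u. u \<in> span A \<Longrightarrow> u \<noteq> 0 \<Longrightarrow> B u u \<noteq> 0"
  shows "\<exists>u\<in>span A. \<forall>y\<in>span A. B (x - u) y = 0"
  using assms
proof (induction A arbitrary: x rule: finite_induct)
  case empty
  then show ?case by (auto simp: form_simps)
next
  case (insert a A)
  have sub: "span A \<subseteq> span (insert a A)" by (intro span_mono) auto
  then have IH: "\<exists>u\<in>span A. \<forall>y\<in>span A. B (x - u) y = 0" for x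
    using insert.IH insert.prems by blast
  obtain p where p: "p \<in> span A" "\<And>y. y \<in> span A \<Longrightarrow> B (a - p) y = 0"
    using IH by blast
  obtain u where u: "u \<in> span A" "\<And>y. y \<in> span A \<Longrightarrow> B (x - u) y = 0"
    using IH by blast
  let ?a = "a - p"
  have a: "?a \<in> span (insert a A)"
    using p sub by (intro span_diff) (auto intro: span_base)
  define v where "v = u + (B x ?a / B ?a ?a) *\<^sub>R ?a"
  have v: "v \<in> span (insert a A)"
    using a u sub unfolding v_def by (intro span_add span_scale) auto
  have ua: "B u ?a = 0" using p(2)[OF u(1)] sym by simp
  have va: "B (x - v) ?a = 0"
  \<comment> \<open>The vector \<open>a - p\<close> is zero exactly when \<open>a\<close> already
    lies in \<open>span A\<close>; then \<open>a\<close> contributes no new direction.\<close>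
  proof (cases "?a = 0")
    case False
    then have "B ?a ?a \<noteq> 0" using insert.prems a by blast
    then have "B v ?a = B x ?a"
      unfolding v_def add_left scaleR_left ua by simp
    then show ?thesis by (simp only: diff_left)
  qed (simp add: form_simps)
  have "B (x - v) y = 0" if y: "y \<in> span (insert a A)" for y
  proof -
    obtain t where "y - t *\<^sub>R a \<in> span A" using y span_breakdown_eq by blast
    then have y': "y - t *\<^sub>R ?a \<in> span A"
      using span_add[OF _ span_scale[OF p(1)], of "y - t *\<^sub>R a" t] by (simp add: algebra_simps)
    have "B (x - v) (y - t *\<^sub>R ?a) = B (x - u) (y - t *\<^sub>R ?a) - (B x ?a / B ?a ?a) * B ?a (y - t *\<^sub>R ?a)"
      unfolding v_def diff_left[of x] add_left scaleR_left by simp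
    also have "\<dots> = 0" using u(2)[OF y'] p(2)[OF y'] by simp
    finally have "B (x - v) y - t * B (x - v) ?a = 0"
      unfolding diff_right[of "x - v" y] scaleR_right by simp
    then show ?thesis using va by simp
  qed
  then show ?case using v by blast
qed

text \<open>A negative definite subspace of \<open>V\<close> meets the \<open>B\<close>-orthogonal
  of \<open>C\<close> only in 0, so the \<open>card C\<close> functionals \<open>B c\<close> bound
  its dimension.\<close>

lemma neg_index_le:
  assumes "finite C" and nonneg: "\<And>x. x \<in> V \<Longrightarrow> \<forall>c\<in>C. B x c = 0 \<Longrightarrow> 0 \<le> B x x"
  shows "neg_index V B \<le> enat (card C)"
  unfolding neg_index_def
proof (rule SUP_least)
  fix U assume "U \<in> {U. subspace U \<and> U \<subseteq> V \<and> neg_definite_on U B}"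
  then have U: "subspace U" "U \<subseteq> V" "neg_definite_on U B" by auto
  have "x = 0" if "x \<in> U" "\<forall>c\<in>C. B c x = 0" for x
  proof -
    have "0 \<le> B x x" using that U(2) nonneg[of x] sym by auto
    then show ?thesis using U(3) that(1) unfolding neg_definite_on_def by force
  qed
  then obtain A where "finite A" "card A \<le> card C" "U \<subseteq> span A"
    using finite_dim_if_common_kernel_trivial[of C B U] assms(1) linear_form U(1) by blast
  then show "edim U \<le> enat (card C)"
    using edim_le_card[of A U] by (meson enat_ord_simps(1) order.trans)
qed

end

text \<open>The projection is found by minimising \<open>v \<mapsto> B (x - v) (x - v)\<close> over \<open>V\<close>; the parallelogram
  identity makes minimising sequences Cauchy.\<close>

lemma coercive_projection:
  fixes B :: "'a::{real_normed_vector, complete_space} \<Rightarrow> 'a \<Rightarrow> real"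
  assumes "symmetric_bilinear B" and V: "subspace V" "closed V"
    and c: "0 < c" and coercive: "\<And>v. v \<in> V \<Longrightarrow> c * (norm v)\<^sup>2 \<le> B v v"
  shows "\<exists>v\<in>V. \<forall>y\<in>V. B (x - v) y = 0"
proof -
  interpret symmetric_bilinear B by fact
  define q where "q v = B (x - v) (x - v)" for v
  obtain M where M: "M > 0" "\<And>a b. norm (B a b) \<le> norm a * norm b * M"
    using pos_bounded by blast
  have bdd: "bdd_below (q ` V)"
  proof (rule bdd_belowI2)
    fix v assume v: "v \<in> V"
    have "B x v \<le> norm x * norm v * M" using M(2)[of x v] by simp
    \<comment> \<open>Completing the square bounds \<open>c * (norm v)\<^sup>2 - 2 * B x v\<close>
      below, independently of \<open>v\<close>.\<close>
    moreover have "c * (norm v - norm x * M / c)\<^sup>2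
        = c * (norm v)\<^sup>2 + (norm x * M)\<^sup>2 / c - 2 * (norm x * norm v * M)"
      using c by (simp add: power2_eq_square field_simps)
    moreover have "0 \<le> c * (norm v - norm x * M / c)\<^sup>2" using c by simp
    ultimately show "B x x - (norm x * M)\<^sup>2 / c \<le> q v"
      using coercive[OF v] sym[of v x] unfolding q_def by (simp add: form_simps)
  qed
  define d where "d = Inf (q ` V)"
  have "V \<noteq> {}" using V(1) subspace_0 by blast
  have d_le: "d \<le> q v" if "v \<in> V" for v
    unfolding d_def using that bdd by (intro cInf_lower) auto
  have "\<exists>v\<in>V. q v < d + 1 / real (Suc n)" for n
    using cInf_less_iff[OF _ bdd, of "d + 1 / real (Suc n)"] \<open>V \<noteq> {}\<close> unfolding d_def by auto
  then obtain w where w: "\<And>n. w n \<in> V" "\<And>n. q (w n) < d + 1 / real (Suc n)"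
    by metis
  have close: "c * (norm (w m - w n))\<^sup>2 \<le> 2 / real (Suc m) + 2 / real (Suc n)" for m n
  proof -
    let ?m = "(1/2) *\<^sub>R (w m + w n)"
    have "q (w m) + q (w n) = 2 * q ?m + B (w m - w n) (w m - w n) / 2"
      using sym[of x "w m"] sym[of x "w n"] sym[of "w m" "w n"]
      unfolding q_def by (simp add: form_simps field_simps)
    moreover have "d \<le> q ?m"
      using V w by (intro d_le) (simp add: subspace_add subspace_scale)
    moreover have "c * (norm (w m - w n))\<^sup>2 \<le> B (w m - w n) (w m - w n)"
      using V w by (intro coercive) (simp add: subspace_diff)
    ultimately show ?thesis using w(2)[of m] w(2)[of n] by linarith
  qed
  have "Cauchy w"
  proof (rule metric_CauchyI)
    fix e :: real assume e: "0 < e"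
    then obtain N where N: "4 / (c * e\<^sup>2) < real N" using reals_Archimedean2 by blast
    have "dist (w m) (w n) < e" if "N \<le> m" "N \<le> n" for m n
    proof -
      have pos: "0 < 4 / (c * e\<^sup>2)" using c e by simp
      then have "0 < real N" using N by linarith
      have "2 / real (Suc m) \<le> 2 / real N" "2 / real (Suc n) \<le> 2 / real N"
        using that \<open>0 < real N\<close> by (auto intro!: divide_left_mono)
      then have "c * (norm (w m - w n))\<^sup>2 \<le> 4 / real N"
        using close[of m n] by linarith
      also have "\<dots> < c * e\<^sup>2"
        using N \<open>0 < real N\<close> c e by (simp add: field_simps)
      finally have "(norm (w m - w n))\<^sup>2 < e\<^sup>2" using c by simp
      then show ?thesis using e by (simp add: dist_norm power_less_imp_less_base)
    qed
    then show "\<exists>N. \<forall>m\<ge>N. \<forall>n\<ge>N. dist (w m) (w n) < e" by blast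
  qed
  then obtain v where lim: "w \<longlonglongrightarrow> v" using Cauchy_convergent convergent_def by blast
  have v: "v \<in> V" using V(2) w(1) lim closed_sequentially by blast
  have "(\<lambda>n. q (w n)) \<longlonglongrightarrow> q v"
    unfolding q_def by (intro tendsto tendsto_diff tendsto_const lim)
  moreover have "(\<lambda>n. d + 1 / real (Suc n)) \<longlonglongrightarrow> d + 0"
    by (intro tendsto_add tendsto_const LIMSEQ_Suc[OF lim_1_over_n])
  ultimately have "q v \<le> d + 0"
    by (rule LIMSEQ_le) (use w(2) in \<open>auto intro: less_imp_le\<close>)
  then have min: "q v \<le> q u" if "u \<in> V" for u using d_le[OF that] by simp
  have "B (x - v) y = 0" if y: "y \<in> V" for y
  proof (cases "y = 0")
    case False
    have "0 < c * (norm y)\<^sup>2" using c False by simp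
    then have pos: "0 < B y y" using coercive[OF y] by linarith
    \<comment> \<open>The minimiser of \<open>q\<close> on the line through \<open>v\<close> in
      direction \<open>y\<close>; the decrease \<open>(B (x - v) y)\<^sup>2 / B y y\<close> it would
      achieve must be zero.\<close>
    define t where "t = B (x - v) y / B y y"
    have "q v \<le> q (v + t *\<^sub>R y)"
      using V(1) v y by (intro min) (simp add: subspace_add subspace_scale)
    also have "q (v + t *\<^sub>R y) = q v - 2 * t * B (x - v) y + t * t * B y y"
      using sym[of y "x - v"] unfolding q_def diff_diff_eq[symmetric]
      by (simp only: diff_left[of "x - v"] diff_right[of _ "x - v"] scaleR_left scaleR_right real_scaleR_def)
        (simp add: algebra_simps)
    also have "t * t * B y y = t * B (x - v) y" using pos by (simp add: t_def)
    finally have "t * B (x - v) y \<le> 0" by simp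
    then have "(B (x - v) y)\<^sup>2 \<le> 0"
      using pos by (simp add: t_def power2_eq_square divide_le_0_iff)
    then show ?thesis by simp
  qed (simp add: form_simps)
  then show ?thesis using v by blast
qed

text \<open>With \<open>M\<close> a bound for \<open>P\<close>, positivity at
  \<open>x - (1/M) *\<^sub>R P x\<close> gives
  \<open>(norm (P x))\<^sup>2 / M \<le> P x \<bullet> x\<close>, and the bound \<open>L\<close> for
  the inverse gives \<open>norm x \<le> norm (P x) * L\<close>.\<close>

lemma positive_isomorphism_coercive:
  fixes P :: "'a::real_inner \<Rightarrow> 'a"
  assumes "positive_isomorphism P"
  shows "\<exists>c>0. \<forall>x. c * (norm x)\<^sup>2 \<le> P x \<bullet> x"
proof -
  have P: "bounded_linear P" "bij P" "bounded_linear (inv P)"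
    and sym: "\<And>x y. P x \<bullet> y = P y \<bullet> x" and pos: "\<And>x. 0 \<le> P x \<bullet> x"
    using assms unfolding positive_isomorphism_def symmetric_form_def by auto
  interpret P: bounded_linear P by fact
  obtain M where M: "M > 0" "\<And>x. norm (P x) \<le> norm x * M"
    using P.pos_bounded by blast
  obtain L where L: "L > 0" "\<And>x. norm (inv P x) \<le> norm x * L"
    using bounded_linear.pos_bounded[OF P(3)] by blast
  have "1 / (M * L\<^sup>2) * (norm x)\<^sup>2 \<le> P x \<bullet> x" for x
  proof -
    have "0 \<le> P (x - (1/M) *\<^sub>R P x) \<bullet> (x - (1/M) *\<^sub>R P x)" by (rule pos)
    also have "\<dots> = P x \<bullet> x - 2 / M * (norm (P x))\<^sup>2 + 1 / M\<^sup>2 * (P (P x) \<bullet> P x)"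
      using sym[of "P x" x]
      by (simp add: P.diff P.scaleR inner_diff_left inner_diff_right power2_norm_eq_inner
          power2_eq_square[of M] diff_divide_distrib)
    finally have 1: "0 \<le> P x \<bullet> x - 2 / M * (norm (P x))\<^sup>2 + 1 / M\<^sup>2 * (P (P x) \<bullet> P x)" .
    have "P (P x) \<bullet> P x \<le> norm (P (P x)) * norm (P x)" by (rule norm_cauchy_schwarz)
    also have "\<dots> \<le> (norm (P x) * M) * norm (P x)" by (intro mult_right_mono M) simp
    finally have "1 / M\<^sup>2 * (P (P x) \<bullet> P x) \<le> 1 / M\<^sup>2 * ((norm (P x) * M) * norm (P x))"
      by (intro mult_left_mono) auto
    also have "\<dots> = 1 / M * (norm (P x))\<^sup>2" using M(1) by (simp add: power2_eq_square)
    finally have 2: "1 / M * (norm (P x))\<^sup>2 \<le> P x \<bullet> x" using 1 by (simp add: field_simps)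
    have "inv P (P x) = x" using P(2) by (simp add: bij_is_inj)
    then have "norm x \<le> norm (P x) * L" using L(2)[of "P x"] by simp
    then have "(norm x)\<^sup>2 \<le> (norm (P x) * L)\<^sup>2" by (intro power_mono) auto
    then have "(norm x)\<^sup>2 / L\<^sup>2 \<le> (norm (P x))\<^sup>2"
      using L(1) by (simp add: power_mult_distrib divide_le_eq)
    then have "1 / M * ((norm x)\<^sup>2 / L\<^sup>2) \<le> 1 / M * (norm (P x))\<^sup>2"
      using M(1) by (intro mult_left_mono) auto
    then show ?thesis using 2 by simp
  qed
  moreover have "0 < 1 / (M * L\<^sup>2)" using M L by simp
  ultimately show ?thesis by blast
qed

section \<open>Forms satisfying a Garding inequality\<close>

text \<open>Of the positive isomorphism only its coercivity constant \<open>c\<close> survives here;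
  the compact part enters as the error term.\<close>

locale garding_form = symmetric_bilinear B
  for B :: "'a::{real_inner, complete_space} \<Rightarrow> 'a \<Rightarrow> real" +
  fixes K :: "'a \<Rightarrow> 'a" and c :: real
  assumes c_pos: "0 < c" and compact_K: "compact_operator K"
    and garding: "c * (norm x)\<^sup>2 \<le> B x x + norm (K x) * norm x"
begin

lemma linear_K: "linear K"
  using compact_K bounded_linear.linear unfolding compact_operator_def by blast

text \<open>On a subspace where \<open>B\<close> is nonpositive, \<open>K\<close> is bounded below, hence it maps an orthonormal
  set to a uniformly discrete set, which is finite by compactness.\<close>

lemma nonpos_imp_finite_dim:
  assumes U: "subspace U" and nonpos: "\<And>x. x \<in> U \<Longrightarrow> B x x \<le> 0"
  shows "\<exists>A. finite A \<and> U \<subseteq> span A"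
proof -
  define \<O> where "\<O> = {E. E \<subseteq> U \<and> pairwise orthogonal E \<and> (\<forall>e\<in>E. norm e = 1)}"
  have "\<exists>E\<in>\<O>. \<forall>X\<in>\<O>. E \<subseteq> X \<longrightarrow> X = E"
  proof (rule subset_Zorn')
    fix \<C> assume \<C>: "subset.chain \<O> \<C>"
    then have "\<C> \<subseteq> \<O>" and tot: "\<And>X Y. X \<in> \<C> \<Longrightarrow> Y \<in> \<C> \<Longrightarrow> X \<subseteq> Y \<or> Y \<subseteq> X"
      unfolding subset_chain_def by auto
    have "pairwise orthogonal (\<Union>\<C>)"
      unfolding pairwise_def
    proof (intro ballI impI)
      fix x y assume "x \<in> \<Union>\<C>" "y \<in> \<Union>\<C>" "x \<noteq> y"
      then obtain X where "X \<in> \<C>" "x \<in> X" "y \<in> X" using tot by blast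
      then show "orthogonal x y"
        using \<open>\<C> \<subseteq> \<O>\<close> \<open>x \<noteq> y\<close> unfolding \<O>_def pairwise_def by blast
    qed
    then show "\<Union>\<C> \<in> \<O>" using \<open>\<C> \<subseteq> \<O>\<close> unfolding \<O>_def by blast
  qed
  then obtain E where "E \<in> \<O>" and max: "\<forall>X\<in>\<O>. E \<subseteq> X \<longrightarrow> X = E"
    by (elim bexE)
  then have E: "E \<subseteq> U" "pairwise orthogonal E" "\<And>e. e \<in> E \<Longrightarrow> norm e = 1"
    unfolding \<O>_def by auto
  have lower: "c * norm x \<le> norm (K x)" if "x \<in> U" for x
  proof (cases "x = 0")
    case False
    have "c * (norm x)\<^sup>2 \<le> norm (K x) * norm x" using garding[of x] nonpos[OF that] by linarith
    then have "(c * norm x) * norm x \<le> norm (K x) * norm x" by (simp add: power2_eq_square)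
    then show ?thesis using False by simp
  qed simp
  have sep: "c \<le> dist (K x) (K y)" if xy: "x \<in> E" "y \<in> E" "x \<noteq> y" for x y
  proof -
    have "x \<bullet> y = 0" using E(2) xy by (auto simp: pairwise_def orthogonal_def)
    moreover have "x \<bullet> x = 1" "y \<bullet> y = 1"
      using E(3)[OF xy(1)] E(3)[OF xy(2)] by (simp_all add: norm_eq_1)
    ultimately have "(norm (x - y))\<^sup>2 = 2"
      by (simp add: power2_norm_eq_inner inner_diff_left inner_diff_right inner_commute)
    then have "1 \<le> norm (x - y)" by (intro power2_le_imp_le[of 1]) simp_all
    then have "c \<le> c * norm (x - y)" using c_pos by simp
    also have "\<dots> \<le> norm (K (x - y))" using E(1) xy subspace_diff[OF U, of x y] by (intro lower) blast
    finally show ?thesis by (simp add: dist_norm linear_diff[OF linear_K])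
  qed
  have "finite E"
  proof (rule ccontr)
    assume inf: "infinite E"
    have "inj_on K E" using sep c_pos by (force intro: inj_onI)
    then have inf': "infinite (K ` E)" using inf finite_imageD by blast
    have "bounded E" using E(3) by (intro boundedI[of _ 1]) auto
    then have "compact (closure (K ` E))"
      using compact_K unfolding compact_operator_def by blast
    then obtain z where "z islimpt (K ` E)"
      using inf' Heine_Borel_imp_Bolzano_Weierstrass[of "closure (K ` E)" "K ` E"] closure_subset by blast
    moreover have "\<not> z islimpt (K ` E)"
      using sep by (intro discrete_imp_not_islimpt[OF c_pos]) (force simp: dist_commute)
    ultimately show False by blast
  qed
  moreover have "U \<subseteq> span E"
  proof
    fix x assume x: "x \<in> U"
    \<comment> \<open>The orthogonal projection of \<open>x\<close> to \<open>span E\<close>, a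
      genuine sum because \<open>E\<close> is finite. A nonzero remainder \<open>x - p\<close>, once
      normalised, would enlarge the maximal orthonormal set \<open>E\<close>.\<close>
    define p where "p = (\<Sum>e\<in>E. (x \<bullet> e) *\<^sub>R e)"
    have p: "p \<in> span E" unfolding p_def by (intro span_sum span_scale span_base)
    then have pU: "p \<in> U" using span_minimal[OF E(1) U] by blast
    have orth: "(x - p) \<bullet> e = 0" if e: "e \<in> E" for e
    proof -
      have "p \<bullet> e = (\<Sum>e'\<in>E. (x \<bullet> e') * (e' \<bullet> e))" unfolding p_def by (simp add: inner_sum_left)
      also have "\<dots> = (\<Sum>e'\<in>E. if e' = e then x \<bullet> e else 0)"
        using E(2) E(3)[OF e] e
        by (intro sum.cong) (auto simp: pairwise_def orthogonal_def norm_eq_1)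
      also have "\<dots> = x \<bullet> e" using e \<open>finite E\<close> by simp
      finally show ?thesis by (simp add: inner_diff_left)
    qed
    have "x - p = 0"
    proof (rule ccontr)
      assume ne: "x - p \<noteq> 0"
      define f where "f = (1 / norm (x - p)) *\<^sub>R (x - p)"
      have f: "f \<in> U" "norm f = 1" "\<And>e. e \<in> E \<Longrightarrow> f \<bullet> e = 0"
        using ne U x pU orth unfolding f_def by (auto simp: subspace_scale subspace_diff)
      then have "insert f E \<in> \<O>"
        using E unfolding \<O>_def by (auto simp: pairwise_insert orthogonal_def inner_commute)
      then have "f \<in> E" using max by blast
      then have "f \<bullet> f = 0" using f(3) by blast
      then show False using f(2) by simp
    qed
    then show "x \<in> span E" using p by simp
  qed
  ultimately show ?thesis by blast
qed

text \<open>The prescribed \<open>A0\<close> allows a basis of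
  \<open>W \<inter> form_ker UNIV B\<close> to be extended to one of
  \<open>W \<inter> S\<close>.\<close>

lemma nonpos_basis:
  assumes U: "subspace U" and nonpos: "\<And>x. x \<in> U \<Longrightarrow> B x x \<le> 0"
    and A0: "independent A0" "A0 \<subseteq> U"
  shows "\<exists>A. A0 \<subseteq> A \<and> finite A \<and> independent A \<and> span A = U"
proof -
  obtain A where A: "A0 \<subseteq> A" "A \<subseteq> U" "independent A" "U \<subseteq> span A"
    using maximal_independent_subset_extend[OF A0(2,1)] by blast
  obtain C where "finite C" "U \<subseteq> span C" using nonpos_imp_finite_dim[OF U nonpos] by blast
  then have "finite A" using A independent_span_bound[of C A] by blast
  moreover have "span A = U" using span_subspace[OF A(2,4) U] .
  ultimately show ?thesis using A by blast
qed

section \<open>Maximal negative definite subspaces\<close>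

text \<open>A vector \<open>x\<close> of \<open>V\<close> orthogonal to \<open>A\<close> with
  \<open>B x x < 0\<close> could be added to the maximal subspace, since \<open>B\<close> is
  diagonal on the sum. The same \<open>A\<close> thus bounds the index from both sides.\<close>

lemma maximal_neg_definite:
  assumes V: "subspace V"
  obtains A where "finite A" "independent A" "span A \<subseteq> V" "neg_definite_on (span A) B"
    "\<And>x. x \<in> V \<Longrightarrow> \<forall>a\<in>A. B x a = 0 \<Longrightarrow> 0 \<le> B x x" "neg_index V B = enat (card A)"
proof -
  define \<N> where "\<N> = {U. subspace U \<and> U \<subseteq> V \<and> neg_definite_on U B}"
  have "\<exists>U\<in>\<N>. \<forall>X\<in>\<N>. U \<subseteq> X \<longrightarrow> X = U"
  proof (rule subset_Zorn_nonempty)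
    have "{0} \<in> \<N>" using V unfolding \<N>_def by (auto simp: neg_definite_on_def subspace_0)
    then show "\<N> \<noteq> {}" by blast
  next
    fix \<C> assume ne: "\<C> \<noteq> {}" and \<C>: "subset.chain \<N> \<C>"
    then have sub: "\<C> \<subseteq> \<N>" and tot: "\<And>X Y. X \<in> \<C> \<Longrightarrow> Y \<in> \<C> \<Longrightarrow> X \<subseteq> Y \<or> Y \<subseteq> X"
      unfolding subset_chain_def by auto
    have subsp: "subspace X" if "X \<in> \<C>" for X using that sub unfolding \<N>_def by auto
    have "subspace (\<Union>\<C>)"
    proof (rule subspaceI)
      show "0 \<in> \<Union>\<C>" using ne subsp subspace_0 by blast
      show "x + y \<in> \<Union>\<C>" if "x \<in> \<Union>\<C>" "y \<in> \<Union>\<C>" for x y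
      proof -
        obtain X where "X \<in> \<C>" "x \<in> X" "y \<in> X" using \<open>x \<in> \<Union>\<C>\<close> \<open>y \<in> \<Union>\<C>\<close> tot by blast
        then show ?thesis using subsp subspace_add by blast
      qed
      show "r *\<^sub>R x \<in> \<Union>\<C>" if "x \<in> \<Union>\<C>" for r x
        using that subsp subspace_scale by blast
    qed
    then show "\<Union>\<C> \<in> \<N>"
      using sub unfolding \<N>_def neg_definite_on_def by blast
  qed
  then obtain U where "U \<in> \<N>" and max: "\<forall>X\<in>\<N>. U \<subseteq> X \<longrightarrow> X = U"
    by (elim bexE)
  then have U: "subspace U" "U \<subseteq> V" "neg_definite_on U B"
    unfolding \<N>_def by auto
  have nonpos: "B x x \<le> 0" if "x \<in> U" for x
    using U(3) that unfolding neg_definite_on_def by (cases "x = 0") (auto simp: form_simps intro: less_imp_le)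
  obtain A where A: "finite A" "independent A" "span A = U"
    using nonpos_basis[OF U(1) nonpos independent_empty empty_subsetI] by blast
  have nonneg: "0 \<le> B x x" if x: "x \<in> V" "\<forall>a\<in>A. B x a = 0" for x
  proof (rule ccontr)
    assume "\<not> 0 \<le> B x x"
    then have neg: "B x x < 0" by simp
    have perp: "B x u = 0" if "u \<in> U" for u using perp_span[of A x u] x(2) that A(3) by blast
    have "neg_definite_on (span (insert x A)) B"
      unfolding neg_definite_on_def
    proof (intro ballI impI)
      fix y assume "y \<in> span (insert x A)" "y \<noteq> 0"
      then obtain t where t: "y - t *\<^sub>R x \<in> U" using span_breakdown_eq A(3) by blast
      define u where "u = y - t *\<^sub>R x"
      have u: "u \<in> U" and y: "y = u + t *\<^sub>R x" using t by (simp_all add: u_def)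
      have eq: "B y y = B u u + t * t * B x x"
        using perp[OF u] sym[of u x] by (simp add: y form_simps)
      show "B y y < 0"
      proof (cases "u = 0")
        case True
        then have "t \<noteq> 0" using y \<open>y \<noteq> 0\<close> by auto
        then have "t * t * B x x < 0" using neg by (intro mult_pos_neg) (auto simp: zero_less_mult_iff)
        then show ?thesis using eq True by (simp add: form_simps)
      next
        case False
        then have "B u u < 0" using u U(3) unfolding neg_definite_on_def by blast
        moreover have "t * t * B x x \<le> 0" using neg by (simp add: mult_nonneg_nonpos)
        ultimately show ?thesis using eq by linarith
      qed
    qed
    moreover have "span (insert x A) \<subseteq> V"
      using x(1) U(2) A(3) span_superset[of A] by (intro span_minimal V) auto
    ultimately have "span (insert x A) \<in> \<N>" unfolding \<N>_def by auto
    moreover have "U \<subseteq> span (insert x A)" using A(3) span_mono[of A "insert x A"] by blast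
    ultimately have "span (insert x A) = U" using max by simp
    then have "x \<in> U" using span_base[of x "insert x A"] by blast
    then show False using perp neg by force
  qed
  have "edim U = enat (card A)"
    using A span_superset[of A] by (intro edim_eq_card_basis) auto
  then have "enat (card A) \<le> neg_index V B"
    unfolding neg_index_def using U by (metis (mono_tags, lifting) SUP_upper mem_Collect_eq)
  moreover have "neg_index V B \<le> enat (card A)"
    using A(1) nonneg by (rule neg_index_le)
  ultimately show ?thesis using that[of A] A U nonneg by (metis order.antisym)
qed

section \<open>Coercivity and the splitting of vectors\<close>

text \<open>Otherwise there are unit vectors \<open>w n\<close> with \<open>B (w n) (w n)\<close>
  below \<open>1 / real (Suc n)\<close>. Along a subsequence \<open>K (w n)\<close> converges, and
  the parallelogram identity with the Garding inequality makes the vectors themselves Cauchy; the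
  limit is a unit vector of \<open>V\<close> on which \<open>B\<close> is at most 0.\<close>

lemma pos_definite_imp_coercive:
  assumes V: "subspace V" "closed V" and pos: "\<And>x. x \<in> V \<Longrightarrow> x \<noteq> 0 \<Longrightarrow> 0 < B x x"
  shows "\<exists>e>0. \<forall>x\<in>V. e * (norm x)\<^sup>2 \<le> B x x"
proof (rule ccontr)
  assume contra: "\<not> ?thesis"
  have nonneg: "0 \<le> B x x" if "x \<in> V" for x
    using pos[OF that] by (cases "x = 0") (auto simp: form_simps intro: less_imp_le)
  have "\<exists>x\<in>V. norm x = 1 \<and> B x x < 1 / real (Suc n)" for n
  proof -
    have "0 < 1 / real (Suc n)" by simp
    then obtain x where x: "x \<in> V" "B x x < 1 / real (Suc n) * (norm x)\<^sup>2"
      using contra by (meson not_le)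
    then have "x \<noteq> 0" by (auto simp: form_simps)
    have "B ((1 / norm x) *\<^sub>R x) ((1 / norm x) *\<^sub>R x) = B x x / (norm x)\<^sup>2"
      by (simp add: form_simps power2_eq_square)
    also have "\<dots> < 1 / real (Suc n)"
      using x(2) \<open>x \<noteq> 0\<close> by (simp add: pos_divide_less_eq)
    finally show ?thesis
      using x(1) \<open>x \<noteq> 0\<close> V(1) by (intro bexI[of _ "(1 / norm x) *\<^sub>R x"]) (auto simp: subspace_scale)
  qed
  then obtain w where w: "\<And>n. w n \<in> V" "\<And>n. norm (w n) = 1" "\<And>n. B (w n) (w n) < 1 / real (Suc n)"
    by metis
  have "bounded (range w)" using w(2) by (intro boundedI[of _ 1]) auto
  then have "compact (closure (K ` range w))"
    using compact_K unfolding compact_operator_def by blast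
  then have "seq_compact (closure (K ` range w))" by (rule compact_imp_seq_compact)
  moreover have "\<forall>n. K (w n) \<in> closure (K ` range w)"
    using closure_subset[of "K ` range w"] by auto
  ultimately obtain z r where r: "strict_mono r" and "((\<lambda>n. K (w n)) \<circ> r) \<longlonglongrightarrow> z"
    by (rule seq_compactE)
  then have CK: "Cauchy (\<lambda>n. K (w (r n)))"
    using LIMSEQ_imp_Cauchy by (auto simp: o_def)
  have small: "B (w (r n)) (w (r n)) < 1 / real (Suc n)" for n
  proof -
    have "1 / real (Suc (r n)) \<le> 1 / real (Suc n)"
      using seq_suble[OF r, of n] by (intro divide_left_mono) auto
    then show ?thesis using w(3)[of "r n"] by linarith
  qed
  have close: "c * (norm (w (r m) - w (r n)))\<^sup>2
      \<le> 2 / real (Suc m) + 2 / real (Suc n) + 2 * dist (K (w (r m))) (K (w (r n)))" for m n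
  proof -
    let ?x = "w (r m)" and ?y = "w (r n)"
    have "B (?x - ?y) (?x - ?y) + B (?x + ?y) (?x + ?y) = 2 * B ?x ?x + 2 * B ?y ?y"
      by (simp add: form_simps)
    moreover have "0 \<le> B (?x + ?y) (?x + ?y)" using V w by (intro nonneg) (simp add: subspace_add)
    moreover have "norm (?x - ?y) \<le> 2" using norm_triangle_ineq4[of ?x ?y] w(2) by simp
    then have "norm (K (?x - ?y)) * norm (?x - ?y) \<le> norm (K (?x - ?y)) * 2"
      by (intro mult_left_mono) auto
    moreover have "norm (K (?x - ?y)) = dist (K ?x) (K ?y)"
      by (simp add: dist_norm linear_diff[OF linear_K])
    ultimately show ?thesis
      using garding[of "?x - ?y"] small[of m] small[of n] by linarith
  qed
  have "Cauchy (\<lambda>n. w (r n))"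
  proof (rule metric_CauchyI)
    fix e :: real assume e: "0 < e"
    \<comment> \<open>Each of the three terms in \<open>close\<close> will be below
      \<open>2 * \<delta>\<close>, so their sum stays under
      \<open>8 * \<delta> = c * e\<^sup>2\<close>.\<close>
    define \<delta> where "\<delta> = c * e\<^sup>2 / 8"
    have \<delta>: "0 < \<delta>" using c_pos e by (simp add: \<delta>_def)
    obtain N1 where N1: "\<And>m n. N1 \<le> m \<Longrightarrow> N1 \<le> n \<Longrightarrow> dist (K (w (r m))) (K (w (r n))) < \<delta>"
      using CK \<delta> unfolding Cauchy_def by blast
    obtain N2 where N2: "1 / real (Suc N2) < \<delta>" using \<delta> nat_approx_posE by blast
    have small': "1 / real (Suc n) < \<delta>" if "N2 \<le> n" for n
    proof -
      have "1 / real (Suc n) \<le> 1 / real (Suc N2)" using that by (intro divide_left_mono) auto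
      then show ?thesis using N2 by linarith
    qed
    have "dist (w (r m)) (w (r n)) < e" if "max N1 N2 \<le> m" "max N1 N2 \<le> n" for m n
    proof -
      have "c * (norm (w (r m) - w (r n)))\<^sup>2 < 8 * \<delta>"
        using close[of m n] N1[of m n] small'[of m] small'[of n] that \<delta> by auto
      then have "(norm (w (r m) - w (r n)))\<^sup>2 < e\<^sup>2" using c_pos by (simp add: \<delta>_def)
      then show ?thesis using e by (simp add: dist_norm power_less_imp_less_base)
    qed
    then show "\<exists>N. \<forall>m\<ge>N. \<forall>n\<ge>N. dist (w (r m)) (w (r n)) < e" by blast
  qed
  then obtain v where lim: "(\<lambda>n. w (r n)) \<longlonglongrightarrow> v" using Cauchy_convergent convergent_def by blast
  have "v \<in> V" using closed_sequentially[OF V(2) _ lim] w(1) by simp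
  have "(\<lambda>n. norm (w (r n))) \<longlonglongrightarrow> norm v" by (intro tendsto_norm lim)
  then have "norm v = 1" using w(2) by (simp add: LIMSEQ_const_iff)
  have "(\<lambda>n. B (w (r n)) (w (r n))) \<longlonglongrightarrow> B v v" by (intro tendsto lim)
  then have "B v v \<le> 0"
    by (rule LIMSEQ_le[OF _ LIMSEQ_Suc[OF lim_1_over_n]]) (use small in \<open>auto intro: less_imp_le\<close>)
  then show False using pos[OF \<open>v \<in> V\<close>] \<open>norm v = 1\<close> by force
qed

text \<open>Closedness of \<open>W\<close> enters here: the vector \<open>w\<close> is the \<open>B\<close>-projection of \<open>x\<close> to a closed
  complement of \<open>span A + W \<inter> form_orthogonal B W\<close> in \<open>W\<close>, on which \<open>B\<close> is coercive.\<close>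

lemma orthogonal_splitting:
  assumes W: "subspace W" "closed W" and A: "finite A" "span A \<subseteq> W" "neg_definite_on (span A) B"
    and nonneg: "\<And>x. x \<in> W \<Longrightarrow> \<forall>a\<in>A. B x a = 0 \<Longrightarrow> 0 \<le> B x x"
    and x: "\<forall>a\<in>A. B x a = 0" "\<forall>y \<in> W \<inter> form_orthogonal B W. B x y = 0"
  shows "\<exists>w\<in>W. (\<forall>a\<in>A. B w a = 0) \<and> x - w \<in> form_orthogonal B W"
proof -
  let ?N = "W \<inter> form_orthogonal B W"
  \<comment> \<open>\<open>B\<close> is nonnegative on \<open>W0\<close> and \<open>?N\<close> is
    the radical of \<open>B\<close> on \<open>W\<close>. Since \<open>V\<close> is the inner-product
    complement of \<open>?N\<close> in \<open>W0\<close>, \<open>W\<close> is the sum of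
    \<open>span A\<close>, \<open>?N\<close> and \<open>V\<close>.\<close>
  define W0 where "W0 = W \<inter> {y. \<forall>a\<in>A. B y a = 0}"
  define V where "V = W0 \<inter> {y. \<forall>n\<in>?N. n \<bullet> y = 0}"
  have AW: "a \<in> W" if "a \<in> A" for a using A(2) that span_base by blast
  have W0: "subspace W0" unfolding W0_def by (intro subspace_inter W subspace_perp)
  have subN: "subspace ?N"
    unfolding form_orthogonal_def by (intro subspace_inter W subspace_perp)
  have NW0: "?N \<subseteq> W0" using AW unfolding W0_def form_orthogonal_def by blast
  have W_decomp: "\<exists>u\<in>span A. y - u \<in> W0" if y: "y \<in> W" for y
  proof -
    have "\<exists>u\<in>span A. \<forall>z\<in>span A. B (y - u) z = 0"
      using A(1,3) by (intro anisotropic_projection) (force simp: neg_definite_on_def)+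
    then obtain u where "u \<in> span A" "\<forall>z\<in>span A. B (y - u) z = 0" by blast
    then show ?thesis using A(2) y W(1) span_base unfolding W0_def
      by (intro bexI[of _ u]) (auto intro: subspace_diff)
  qed
  \<comment> \<open>A null vector of the semidefinite \<open>W0\<close> is orthogonal to
    \<open>W0\<close>, and to \<open>span A\<close> by definition of \<open>W0\<close>, hence to all
    of \<open>W\<close>.\<close>
  have null: "y \<in> ?N" if y: "y \<in> W0" "B y y = 0" for y
  proof -
    have "B y z = 0" if z: "z \<in> W" for z
    proof -
      obtain u where u: "u \<in> span A" "z - u \<in> W0" using W_decomp[OF z] by blast
      have "B y (z - u) = 0"
        using semidefinite_null_perp[OF W0 _ y u(2)] nonneg unfolding W0_def by blast
      moreover have "B y u = 0" using perp_span[of A y u] y(1) u(1) unfolding W0_def by blast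
      ultimately show ?thesis by (simp add: form_simps)
    qed
    then show ?thesis using y(1) unfolding W0_def form_orthogonal_def by blast
  qed
  have nonposN: "B y y \<le> 0" if "y \<in> ?N" for y using that unfolding form_orthogonal_def by auto
  obtain E where E: "finite E" "span E = ?N"
    using nonpos_basis[OF subN nonposN independent_empty empty_subsetI] by blast
  \<comment> \<open>Makes \<open>anisotropic_projection\<close> available as orthogonal projection
    to the finite-dimensional \<open>?N\<close>.\<close>
  interpret inner: symmetric_bilinear "inner :: 'a \<Rightarrow> 'a \<Rightarrow> real"
    by (simp add: symmetric_bilinear_def symmetric_bilinear_axioms_def bounded_bilinear_inner inner_commute)
  have W0_decomp: "\<exists>n\<in>?N. y - n \<in> V" if y: "y \<in> W0" for y
  proof -
    have "\<exists>n\<in>span E. \<forall>z\<in>span E. (y - n) \<bullet> z = 0"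
      using E(1) by (intro inner.anisotropic_projection) auto
    then obtain n where n: "n \<in> ?N" "\<forall>z\<in>?N. (y - n) \<bullet> z = 0" using E(2) by blast
    then have "y - n \<in> W0" using NW0 y W0 by (intro subspace_diff) auto
    then show ?thesis using n unfolding V_def by (intro bexI[of _ n]) (auto simp: inner_commute)
  qed
  have subV: "subspace V"
    unfolding V_def by (intro subspace_inter W0) (auto simp: subspace_def inner_add_right)
  have "closed V"
  proof -
    have "V = W \<inter> (\<Inter>a\<in>A. {y. B y a = 0}) \<inter> (\<Inter>n\<in>?N. {y. n \<bullet> y = 0})"
      unfolding V_def W0_def by auto
    moreover have "closed {y. B y a = 0}" for a
      by (intro closed_Collect_eq continuous_on continuous_on_id continuous_on_const)
    moreover have "closed {y. n \<bullet> y = 0}" for n :: 'a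
      by (intro closed_Collect_eq continuous_intros)
    ultimately show ?thesis using W(2) by (metis (no_types, lifting) closed_INT closed_Int)
  qed
  have "0 < B y y" if y: "y \<in> V" "y \<noteq> 0" for y
  proof -
    have "y \<in> W0" using y unfolding V_def by blast
    then have "0 \<le> B y y" using nonneg unfolding W0_def by blast
    moreover have "B y y \<noteq> 0"
    proof
      assume "B y y = 0"
      then have "y \<in> ?N" using null \<open>y \<in> W0\<close> by blast
      then have "y \<bullet> y = 0" using y(1) unfolding V_def by blast
      then show False using y(2) by simp
    qed
    ultimately show ?thesis by simp
  qed
  then obtain e where e: "0 < e" "\<And>y. y \<in> V \<Longrightarrow> e * (norm y)\<^sup>2 \<le> B y y"
    using pos_definite_imp_coercive[OF subV \<open>closed V\<close>] by blast
  obtain w where w: "w \<in> V" "\<And>y. y \<in> V \<Longrightarrow> B (x - w) y = 0"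
    using coercive_projection[OF symmetric_bilinear_axioms subV \<open>closed V\<close> e, of x] by blast
  have wW: "w \<in> W" and wA: "\<forall>a\<in>A. B w a = 0" using w(1) unfolding V_def W0_def by auto
  \<comment> \<open>Checked on the three summands of \<open>W\<close>: on \<open>span A\<close> and
    \<open>?N\<close> both \<open>x\<close> and \<open>w\<close> are orthogonal, on \<open>V\<close>
    this is the projection property.\<close>
  have "B (x - w) y = 0" if y: "y \<in> W" for y
  proof -
    obtain u where u: "u \<in> span A" "y - u \<in> W0" using W_decomp[OF y] by blast
    obtain n where n: "n \<in> ?N" "y - u - n \<in> V" using W0_decomp[OF u(2)] by blast
    have "B (x - w) u = 0" using perp_span[of A "x - w" u] x(1) wA u(1) by (simp add: form_simps)
    moreover have "B n w = 0" using n(1) wW unfolding form_orthogonal_def by blast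
    then have "B (x - w) n = 0" using x(2) n(1) sym[of n w] by (simp add: diff_left)
    moreover have "B (x - w) (y - u - n) = 0" using w(2)[OF n(2)] .
    ultimately show ?thesis by (simp add: diff_right)
  qed
  then show ?thesis using wW wA unfolding form_orthogonal_def by blast
qed

section \<open>The index formula\<close>

text \<open>With \<open>Z\<close> a basis of a maximal negative definite subspace, \<open>B\<close>
  is nonnegative on the orthogonal of \<open>Z\<close> and nonpositive on \<open>span D\<close>. A
  common vector is null, hence in the kernel, hence 0, so the \<open>card Z\<close> functionals
  bound \<open>card D\<close>.\<close>

lemma card_le_neg_index:
  assumes D: "finite D" "independent D" "\<And>x. x \<in> span D \<Longrightarrow> B x x \<le> 0"
    and ker: "span D \<inter> form_ker UNIV B \<subseteq> {0}"
  shows "enat (card D) \<le> neg_index UNIV B"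
proof -
  obtain Z where Z: "finite Z" "neg_definite_on (span Z) B"
    "\<And>x. \<forall>a\<in>Z. B x a = 0 \<Longrightarrow> 0 \<le> B x x" "neg_index UNIV B = enat (card Z)"
    using maximal_neg_definite[OF subspace_UNIV] by (metis UNIV_I)
  have "x = 0" if x: "x \<in> span D" "\<forall>a\<in>Z. B a x = 0" for x
  proof -
    have xZ: "\<forall>a\<in>Z. B x a = 0" using x(2) sym by metis
    then have 0: "B x x = 0" using Z(3)[of x] D(3)[OF x(1)] by simp
    have "B x y = 0" for y
    proof -
      \<comment> \<open>Splits \<open>y\<close> into a part in \<open>span Z\<close> and a part
        orthogonal to \<open>Z\<close>; \<open>x\<close> is orthogonal to each.\<close>
      have "\<exists>u\<in>span Z. \<forall>z\<in>span Z. B (y - u) z = 0"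
        using Z(1,2) by (intro anisotropic_projection) (force simp: neg_definite_on_def)+
      then obtain u where u: "u \<in> span Z" "\<forall>z\<in>span Z. B (y - u) z = 0" by blast
      have "B x (y - u) = 0"
        using semidefinite_null_perp[OF subspace_perp[of Z], of x "y - u"] Z(3) xZ 0 u(2) span_base
        by blast
      moreover have "B x u = 0" using perp_span[of Z x u] xZ u(1) by blast
      ultimately show ?thesis by (simp add: form_simps)
    qed
    then show ?thesis using ker x(1) unfolding form_ker_def by blast
  qed
  then obtain A where A: "finite A" "card A \<le> card Z" "span D \<subseteq> span A"
    using finite_dim_if_common_kernel_trivial[of Z B "span D"] Z(1) linear_form by blast
  then have "card D \<le> card A"
    using independent_span_bound[OF A(1) D(2)] span_superset[of D] by blast
  then show ?thesis using A(2) Z(4) by simp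
qed

theorem neg_index_splitting:
  assumes W: "subspace W" "closed W" and S: "S = form_orthogonal B W"
  shows "\<exists>n nW nS d k :: nat.
           neg_index UNIV B = enat n \<and>
           neg_index W B = enat nW \<and>
           neg_index S B = enat nS \<and>
           edim (W \<inter> S) = enat d \<and>
           edim (W \<inter> form_ker UNIV B) = enat k \<and>
           int n = int nW + int nS + int d - int k"
proof -
  let ?ker = "form_ker UNIV B"
  have subS: "subspace S" unfolding S form_orthogonal_def by (rule subspace_perp)
  have kerS: "?ker \<subseteq> S" unfolding S form_orthogonal_def form_ker_def by blast
  have "?ker = {y. \<forall>x\<in>UNIV. B y x = 0}" unfolding form_ker_def by simp
  then have sub_ker: "subspace ?ker" using subspace_perp[of UNIV] by simp
  have WS: "B x y = 0" "B y x = 0" if "x \<in> W" "y \<in> S" for x y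
    using that sym[of x y] unfolding S form_orthogonal_def by auto
  obtain A where A: "finite A" "independent A" "span A \<subseteq> W" "neg_definite_on (span A) B"
    "\<And>x. x \<in> W \<Longrightarrow> \<forall>a\<in>A. B x a = 0 \<Longrightarrow> 0 \<le> B x x" "neg_index W B = enat (card A)"
    using maximal_neg_definite[OF W(1)] by blast
  obtain C where C: "finite C" "independent C" "span C \<subseteq> S" "neg_definite_on (span C) B"
    "\<And>x. x \<in> S \<Longrightarrow> \<forall>a\<in>C. B x a = 0 \<Longrightarrow> 0 \<le> B x x" "neg_index S B = enat (card C)"
    using maximal_neg_definite[OF subS] by blast
  have nonpos_ker: "B x x \<le> 0" if "x \<in> W \<inter> ?ker" for x using that unfolding form_ker_def by auto
  obtain H where H: "finite H" "independent H" "span H = W \<inter> ?ker"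
    using nonpos_basis[OF subspace_inter[OF W(1) sub_ker] nonpos_ker independent_empty empty_subsetI] by blast
  have HN: "H \<subseteq> W \<inter> S" using H(3) span_superset[of H] kerS by blast
  have nonpos_WS: "B x x \<le> 0" if "x \<in> W \<inter> S" for x using that WS by auto
  obtain G where G: "H \<subseteq> G" "finite G" "independent G" "span G = W \<inter> S"
    using nonpos_basis[OF subspace_inter[OF W(1) subS] nonpos_WS H(2) HN] by blast
  \<comment> \<open>Spans a complement of \<open>W \<inter> ?ker\<close> in
    \<open>W \<inter> S\<close>, so \<open>card F\<close> is the difference of the two dimensions in
    the formula.\<close>
  define F where "F = G - H"
  have GHF: "G = H \<union> F" "H \<inter> F = {}" using G(1) unfolding F_def by auto
  have F: "finite F" "independent F" using G independent_mono[of G F] unfolding F_def by auto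
  have FN: "span F \<subseteq> W \<inter> S" using span_mono[of F G] G(4) unfolding F_def by blast
  have "span H \<inter> span F \<subseteq> {0}"
    using span_Int_if_independent_Un[of F H] GHF F(1) G(3) by simp
  then have F_ker: "span F \<inter> ?ker \<subseteq> {0}" using H(3) FN by blast
  have cardG: "card G = card H + card F"
    using GHF H(1) F(1) by (simp add: card_Un_disjoint)

  have negA: "x = 0" if "x \<in> span A" "0 \<le> B x x" for x
    using A(4) that unfolding neg_definite_on_def by force
  have negC: "x = 0" if "x \<in> span C" "0 \<le> B x x" for x
    using C(4) that unfolding neg_definite_on_def by force
  have nonposA: "B x x \<le> 0" if "x \<in> span A" for x
    using negA[OF that] by (cases "0 \<le> B x x") (auto simp: form_simps)
  have nonposC: "B x x \<le> 0" if "x \<in> span C" for x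
    using negC[OF that] by (cases "0 \<le> B x x") (auto simp: form_simps)
  \<comment> \<open>All cross terms and \<open>B f f\<close> vanish because \<open>f\<close> lies in
    both \<open>W\<close> and \<open>S\<close>, which are mutually orthogonal.\<close>
  have expand: "B (a + b + f) (a + b + f) = B a a + B b b"
    if "a \<in> span A" "b \<in> span C" "f \<in> span F" for a b f
  proof -
    have "a \<in> W" "b \<in> S" "f \<in> W" "f \<in> S" using that A(3) C(3) FN by auto
    then show ?thesis using WS by (simp add: form_simps)
  qed
  have AC: "span A \<inter> span C \<subseteq> {0}"
  proof
    fix x assume x: "x \<in> span A \<inter> span C"
    then have "B x x = 0" using WS(1)[of x x] A(3) C(3) by blast
    then show "x \<in> {0}" using negA[of x] x by simp
  qed
  have indAC: "independent (A \<union> C)"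
    using independent_Un_if_span_Int C(1) A(2) C(2) AC by blast
  have ACF: "span (A \<union> C) \<inter> span F \<subseteq> {0}"
  proof
    fix x assume x: "x \<in> span (A \<union> C) \<inter> span F"
    then obtain a b where ab: "x = a + b" "a \<in> span A" "b \<in> span C" unfolding span_Un by blast
    have "x \<in> W" "x \<in> S" using x FN by auto
    then have "B x x = 0" using WS by blast
    then have "B a a + B b b = 0" using expand[OF ab(2,3) span_zero] ab(1) by simp
    then have "a = 0" "b = 0" using nonposA[OF ab(2)] nonposC[OF ab(3)] negA[OF ab(2)] negC[OF ab(3)] by auto
    then show "x \<in> {0}" using ab(1) by simp
  qed
  define D where "D = A \<union> C \<union> F"
  have "finite D" using A(1) C(1) F(1) unfolding D_def by simp
  have indD: "independent D"
    unfolding D_def using independent_Un_if_span_Int F indAC ACF by blast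
  have disj: "X \<inter> Y = {}" if "span X \<inter> span Y \<subseteq> {0}" "independent X" for X Y :: "'a set"
    using that span_superset[of X] span_superset[of Y] dependent_zero[of X] by blast
  have cardD: "card D = card A + card C + card F"
    unfolding D_def using disj[OF AC A(2)] disj[OF ACF indAC] A(1) C(1) F(1)
    by (simp add: card_Un_disjoint)
  have spanD: "\<exists>a b f. x = a + b + f \<and> a \<in> span A \<and> b \<in> span C \<and> f \<in> span F" if "x \<in> span D" for x
    using that unfolding D_def span_Un by blast

  have "enat (card D) \<le> neg_index UNIV B"
  proof (rule card_le_neg_index[OF \<open>finite D\<close> indD])
    show "B x x \<le> 0" if x: "x \<in> span D" for x
    proof -
      obtain a b f where abf: "x = a + b + f" "a \<in> span A" "b \<in> span C" "f \<in> span F"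
        using spanD[OF x] by blast
      then show ?thesis using expand[OF abf(2-4)] nonposA[OF abf(2)] nonposC[OF abf(3)] by simp
    qed
    show "span D \<inter> ?ker \<subseteq> {0}"
    proof
      fix x assume x: "x \<in> span D \<inter> ?ker"
      then obtain a b f where abf: "x = a + b + f" "a \<in> span A" "b \<in> span C" "f \<in> span F"
        using spanD by blast
      have "B x x = 0" using x unfolding form_ker_def by blast
      then have "B a a + B b b = 0" using expand[OF abf(2-4)] abf(1) by simp
      then have "a = 0" "b = 0" using nonposA[OF abf(2)] nonposC[OF abf(3)] negA[OF abf(2)] negC[OF abf(3)] by auto
      then show "x \<in> {0}" using abf(1,4) x F_ker by auto
    qed
  qed
  moreover have "neg_index UNIV B \<le> enat (card D)"
  proof (rule neg_index_le[OF \<open>finite D\<close>])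
    fix x assume x: "\<forall>a\<in>D. B x a = 0"
    \<comment> \<open>As \<open>H\<close> lies in the kernel, orthogonality of \<open>x\<close> to
      \<open>F\<close> already gives orthogonality to \<open>G\<close>, that is, to all of
      \<open>W \<inter> S\<close>, as \<open>orthogonal_splitting\<close> requires.\<close>
    have xH: "B x h = 0" if "h \<in> H" for h
      using that H(3) span_superset[of H] sym[of x h] unfolding form_ker_def by auto
    have xN: "\<forall>y \<in> W \<inter> form_orthogonal B W. B x y = 0"
    proof
      fix y assume "y \<in> W \<inter> form_orthogonal B W"
      then have "y \<in> span G" using G(4) S by simp
      then show "B x y = 0" using perp_span[of G x y] xH x GHF(1) unfolding D_def by blast
    qed
    have "\<forall>a\<in>A. B x a = 0" using x unfolding D_def by blast
    then obtain w where w: "w \<in> W" "\<forall>a\<in>A. B w a = 0" "x - w \<in> S"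
      using orthogonal_splitting[OF W A(1,3,4,5) _ xN] S by blast
    have "\<forall>b\<in>C. B (x - w) b = 0"
    proof
      fix b assume b: "b \<in> C"
      then have "B w b = 0" using WS w(1) C(3) span_base by blast
      then show "B (x - w) b = 0" using x b unfolding D_def by (simp add: diff_left)
    qed
    then have "0 \<le> B (x - w) (x - w)" using C(5)[OF w(3)] by blast
    moreover have "0 \<le> B w w" using A(5) w by blast
    moreover have "B x x = B w w + B (x - w) (x - w)"
      using WS[OF w(1,3)] by (simp add: form_simps)
    ultimately show "0 \<le> B x x" by simp
  qed
  ultimately have "neg_index UNIV B = enat (card D)" by (rule order.antisym[rotated])
  moreover have "edim (W \<inter> S) = enat (card G)"
    using G span_superset[of G] by (intro edim_eq_card_basis) auto
  moreover have "edim (W \<inter> ?ker) = enat (card H)"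
    using H span_superset[of H] by (intro edim_eq_card_basis) auto
  moreover have "int (card D) = int (card A) + int (card C) + int (card G) - int (card H)"
    using cardD cardG by simp
  ultimately show ?thesis using A(6) C(6) by blast
qed

end

section \<open>From essential positivity to the Garding inequality\<close>

lemma essentially_positive_imp_garding_form:
  fixes B :: "'a::{real_inner, complete_space} \<Rightarrow> 'a \<Rightarrow> real"
  assumes "bounded_bilinear B" "symmetric_form B" "essentially_positive B"
  shows "\<exists>K c. garding_form B K c"
proof -
  obtain P K where P: "positive_isomorphism P" and K: "compact_operator K"
    and B: "\<And>x y. B x y = (P x + K x) \<bullet> y"
    using assms(3) unfolding essentially_positive_def by auto
  obtain c where c: "0 < c" "\<And>x. c * (norm x)\<^sup>2 \<le> P x \<bullet> x"
    using positive_isomorphism_coercive[OF P] by blast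
  have "c * (norm x)\<^sup>2 \<le> B x x + norm (K x) * norm x" for x
    using c(2)[of x] Cauchy_Schwarz_ineq2[of "K x" x] unfolding B inner_add_left by linarith
  then have "garding_form B K c"
    using assms(1,2) c(1) K
    unfolding garding_form_def garding_form_axioms_def symmetric_bilinear_def
      symmetric_bilinear_axioms_def symmetric_form_def by blast
  then show ?thesis by blast
qed

theorem theorem3p10:
  fixes B :: "'a::{real_inner, complete_space} \<Rightarrow> 'a \<Rightarrow> real" and W S :: "'a set"
  assumes "bounded_bilinear B"
    and "symmetric_form B"
    and "essentially_positive B"
    and "subspace W" and "closed W"
    and "S = form_orthogonal B W"
  shows "\<exists>n nW nS d k :: nat.
           neg_index UNIV B = enat n \<and>
           neg_index W B = enat nW \<and>
           neg_index S B = enat nS \<and>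
           edim (W \<inter> S) = enat d \<and>
           edim (W \<inter> form_ker UNIV B) = enat k \<and>
           int n = int nW + int nS + int d - int k"
proof -
  obtain K c where "garding_form B K c"
    using essentially_positive_imp_garding_form[OF assms(1-3)] by blast
  then show ?thesis
    using garding_form.neg_index_splitting[OF _ assms(4-6)] by blast
qed

end
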